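(* Let $s,r\in\mathbb N_+$, $\beta,\lambda>0$, and let $(a^{(\ell)}_{ij})_{i,j=1}^s,(b^{(\ell)}_i)_{i=1}^s$ for $\ell=1,2,3,4$, $(\tilde a^{(\ell)}_{mn})_{m,n=1}^r,(\tilde b^{(\ell)}_m)_{m=1}^r$ for $\ell=1,2$, and $(\bar a_{mn})_{m,n=1}^r,(\bar b_m)_{m=1}^r$ be real coefficients. Consider the partitioned Runge--Kutta method for the stochastic Korteweg--de Vries equation given, for $i=1,\dots,s$ and $m=1,\dots,r$, by \begin{align*} &U_i^m=u_i^0+\Delta t\sum_{n=1}^r\tilde a^{(1)}_{nm}\big(-2\,\delta_xV_i^n\big)+\sum_{n=1}^r2\lambda\,\Delta W_i^1\,\bar a_{nm},\\ &\mathcal P_i^m=\rho_i^0+\Delta t\sum_{n=1}^r\tilde a^{(2)}_{nm}\big(-2\beta\,\delta_x\mathcal W_i^n+2V_i^n-(U_i^n)^2\big),\\ &u_i^1=u_i^0+\Delta t\sum_{m=1}^r\tilde b^{(1)}_m\big(-2\,\delta_xV_i^m\big)+\sum_{m=1}^r2\lambda\,\Delta W_i^1\,\bar b_m,\\ &\rho_i^1=\rho_i^0+\Delta t\sum_{m=1}^r\tilde b^{(2)}_m\big(-2\beta\,\delta_x\mathcal W_i^m+2V_i^m-(U_i^m)^2\big),\\ &U_i^m=u_0^m+\Delta x\sum_{j=1}^sa^{(1)}_{ij}\mathcal W_j^m,\qquad \mathcal P_i^m=\rho_0^m+\Delta x\sum_{j=1}^sa^{(2)}_{ij}U_j^m,\\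 &V_i^m=v_0^m+\Delta x\sum_{j=1}^sa^{(3)}_{ij}\,\delta_xV_j^m,\qquad \mathcal W_i^m=w_0^m+\Delta x\sum_{j=1}^sa^{(4)}_{ij}\,\delta_x\mathcal W_j^m,\\ &u_1^m=u_0^m+\Delta x\sum_{i=1}^sb^{(1)}_i\mathcal W_i^m,\qquad \rho_1^m=\rho_0^m+\Delta x\sum_{i=1}^sb^{(2)}_iU_i^m,\\ &v_1^m=v_0^m+\Delta x\sum_{i=1}^sb^{(3)}_i\,\delta_xV_i^m,\qquad w_1^m=w_0^m+\Delta x\sum_{i=1}^sb^{(4)}_i\,\delta_x\mathcal W_i^m . \end{align*} Suppose that for $1\le i,j\le s$ and $1\le m,n\le r$ \begin{align*} &\tilde a^{(1)}_{mn}\tilde b^{(2)}_n+\tilde b^{(1)}_m\tilde a^{(2)}_{nm}-\tilde b^{(1)}_m\tilde b^{(2)}_n=0,\qquad \bar a_{mn}\tilde b^{(2)}_n+\bar b_m\tilde a^{(2)}_{nm}-\bar b_m\tilde b^{(2)}_n=0,\\ &a^{(3)}_{ij}b^{(2)}_i+b^{(3)}_ja^{(2)}_{ji}-b^{(2)}_ib^{(3)}_j=0,\qquad a^{(1)}_{ij}b^{(4)}_i+b^{(1)}_ja^{(4)}_{ji}-b^{(4)}_ib^{(1)}_j=0,\\ &b^{(2)}_i=b^{(3)}_i,\qquad b^{(2)}_i=b^{(4)}_i,\qquad \tilde b^{(1)}_m=\tilde b^{(2)}_m . \end{align*} Then the method satisfies, almost surely, the discrete multi-symplectic conservation law $$\sum_{i=1}^s\frac{b^{(2)}_i}{\Delta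 t}\big(\mathrm d\rho_i^1\wedge\mathrm du_i^1-\mathrm d\rho_i^0\wedge\mathrm du_i^0\big)+\sum_{m=1}^r\frac{\tilde b^{(2)}_m}{\Delta x}\big(2\,\mathrm d\rho_1^m\wedge\mathrm dv_1^m-2\,\mathrm d\rho_0^m\wedge\mathrm dv_0^m+2\beta\,\mathrm dw_1^m\wedge\mathrm du_1^m-2\beta\,\mathrm dw_0^m\wedge\mathrm du_0^m\big)=0 .$$
   Context: The stochastic KdV equation is $du+uu_x\,dt+\beta u_{xxx}\,dt=\lambda\,dW(t)$, $\beta,\lambda>0$, rewritten as $-\frac12d\rho-\beta w_x\,dt=\frac12u^2\,dt-v\,dt$, $\rho_x=u$, $\frac12du+v_x\,dt=\lambda\,dW(t)$, $u_x=w$. $W$ is a real $L^2$-valued $Q$-Wiener process with trace-class $Q$. The method treats one space-time cell $[0,\Delta x]\times[0,\Delta t]$. All quantities are real numbers for each realization of the noise. Stage quantities $U_i^m,V_i^m,\mathcal P_i^m,\mathcal W_i^m$ approximate $u,v,\rho,w$ at spatial stage $i$ and temporal stage $m$; $\delta_xV_i^m,\delta_x\mathcal W_i^m$ are the stage quantities discretizing $\partial_xv,\partial_xw$. Superscripts $0,1$ on $u_i,\rho_i$ refer to times $0,\Delta t$ at spatial stage $i$; subscripts $0,1$ on $u^m,v^m,\rho^m,w^m$ refer to $x=0,\Delta x$ at temporal stage $m$ (quantities indexed by a spatial stage and by a temporal stage are different families). $\Delta W_i^1$ is the (real-valued) increment of $W$ over $[0,\Delta t]$ at the spatial stage point $i$.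 $\mathrm d$ (roman) is the exterior derivative: for a fixed realization of the noise, all numerical quantities are regarded as differentiable functions of parameters (e.g. the data), so their differentials satisfy the linearized scheme and noise increments carry no differential. *)

theory Defs
  imports "HOL-Probability.Probability"
begin

section \<open>Real \<open>L\<^sup>2\<close>-valued Q-Wiener processes\<close>

text \<open>
  Elements of \<open>L\<^sup>2(D)\<close> are represented by functions on the real line, considered up to
  equality almost everywhere on \<open>D\<close>.
\<close>

definition L2_fun :: "real set \<Rightarrow> (real \<Rightarrow> real) set" where
  "L2_fun D = {f. f \<in> borel_measurable (lebesgue_on D) \<and> integrable (lebesgue_on D) (\<lambda>y. (f y)\<^sup>2)}"

definition L2_inner :: "real set \<Rightarrow> (real \<Rightarrow> real) \<Rightarrow> (real \<Rightarrow> real) \<Rightarrow> real" where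
  "L2_inner D f g = (\<integral>y. f y * g y \<partial>(lebesgue_on D))"

text \<open>
  Nonnegative self-adjoint trace-class operators on \<open>L\<^sup>2(D)\<close>.  An everywhere defined symmetric
  map is automatically linear (up to null sets) and bounded (Hellinger--Toeplitz); a nonnegative
  operator is trace class iff its partial traces over finite orthonormal systems are bounded.
\<close>

definition trace_class_covariance :: "real set \<Rightarrow> ((real \<Rightarrow> real) \<Rightarrow> (real \<Rightarrow> real)) \<Rightarrow> bool" where
  "trace_class_covariance D Q \<longleftrightarrow>
     (\<forall>f\<in>L2_fun D. Q f \<in> L2_fun D) \<and>
     (\<forall>f\<in>L2_fun D. \<forall>g\<in>L2_fun D. L2_inner D (Q f) g = L2_inner D f (Q g)) \<and>
     (\<forall>f\<in>L2_fun D. 0 \<le> L2_inner D (Q f) f) \<and>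
     (\<exists>C. \<forall>(n::nat) e.
        (\<forall>k<n. e k \<in> L2_fun D) \<and>
        (\<forall>j<n. \<forall>k<n. L2_inner D (e j) (e k) = (if j = k then 1 else 0)) \<longrightarrow>
        (\<Sum>k<n. L2_inner D (Q (e k)) (e k)) \<le> C)"

definition centred_normal :: "'w measure \<Rightarrow> ('w \<Rightarrow> real) \<Rightarrow> real \<Rightarrow> bool" where
  "centred_normal M X var \<longleftrightarrow>
     X \<in> borel_measurable M \<and>
     (if var = 0 then (AE \<omega> in M. X \<omega> = 0)
      else distributed M lborel X (normal_density 0 (sqrt var)))"

text \<open>
  \<open>W t \<omega>\<close> is a representative of the value at time \<open>t\<close>, so that \<open>W t \<omega> y\<close> is the value at the
  spatial point \<open>y\<close>.  Since \<open>L\<^sup>2(D)\<close> is separable, laws and independence of increments are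
  determined by their scalar products with test functions; independence is required for
  arbitrary, increment-dependent test functions \<open>h k\<close>.
\<close>

definition Q_Wiener_process ::
    "'w measure \<Rightarrow> real set \<Rightarrow> ((real \<Rightarrow> real) \<Rightarrow> (real \<Rightarrow> real)) \<Rightarrow>
     (real \<Rightarrow> 'w \<Rightarrow> real \<Rightarrow> real) \<Rightarrow> bool" where
  "Q_Wiener_process M D Q W \<longleftrightarrow>
     prob_space M \<and>
     trace_class_covariance D Q \<and>
     (\<forall>t\<ge>0. \<forall>\<omega>\<in>space M. W t \<omega> \<in> L2_fun D) \<and>
     (\<forall>t\<ge>0. \<forall>h\<in>L2_fun D. (\<lambda>\<omega>. L2_inner D (W t \<omega>) h) \<in> borel_measurable M) \<and>
     (AE \<omega> in M. AE y in lebesgue_on D. W 0 \<omega> y = 0) \<and>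
     (AE \<omega> in M. \<forall>t\<ge>0.
        ((\<lambda>t'. \<integral>y. (W t' \<omega> y - W t \<omega> y)\<^sup>2 \<partial>(lebesgue_on D)) \<longlongrightarrow> 0) (at t within {0..})) \<and>
     (\<forall>(n::nat) \<tau> h.
        0 \<le> \<tau> 0 \<and> (\<forall>k<n. \<tau> k \<le> \<tau> (Suc k)) \<and> (\<forall>k<n. h k \<in> L2_fun D) \<longrightarrow>
        prob_space.indep_vars M (\<lambda>_. borel)
          (\<lambda>k \<omega>. L2_inner D (\<lambda>y. W (\<tau> (Suc k)) \<omega> y - W (\<tau> k) \<omega> y) (h k)) {..<n}) \<and>
     (\<forall>t t'. \<forall>h\<in>L2_fun D. 0 \<le> t \<and> t < t' \<longrightarrow>
        centred_normal M (\<lambda>\<omega>. L2_inner D (\<lambda>y. W t' \<omega> y - W t \<omega> y) h)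
          ((t' - t) * L2_inner D (Q h) h))"

section \<open>The partitioned Runge--Kutta method on one space-time cell\<close>

text \<open>
  Stage fields take a spatial stage \<open>i\<close> and a temporal stage \<open>m\<close>, e.g. \<open>stage_u z i m\<close> is
  \<open>U\<close> at \<open>(i, m)\<close>.  The fields \<open>time_u\<close>, \<open>time_rho\<close> take \<open>k \<in> {0, 1}\<close> (time \<open>0\<close> or \<open>\<Delta>t\<close>) and a
  spatial stage; the fields \<open>side_u\<close>, \<open>side_v\<close>, \<open>side_rho\<close>, \<open>side_w\<close> take \<open>k \<in> {0, 1}\<close>
  (position \<open>0\<close> or \<open>\<Delta>x\<close>) and a temporal stage.  \<open>stage_dxv\<close>, \<open>stage_dxw\<close> are the independent
  unknowns discretizing the spatial derivatives of \<open>v\<close> and \<open>w\<close>.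
\<close>

record cell =
  stage_u :: "nat \<Rightarrow> nat \<Rightarrow> real"
  stage_v :: "nat \<Rightarrow> nat \<Rightarrow> real"
  stage_rho :: "nat \<Rightarrow> nat \<Rightarrow> real"
  stage_w :: "nat \<Rightarrow> nat \<Rightarrow> real"
  stage_dxv :: "nat \<Rightarrow> nat \<Rightarrow> real"
  stage_dxw :: "nat \<Rightarrow> nat \<Rightarrow> real"
  time_u :: "nat \<Rightarrow> nat \<Rightarrow> real"
  time_rho :: "nat \<Rightarrow> nat \<Rightarrow> real"
  side_u :: "nat \<Rightarrow> nat \<Rightarrow> real"
  side_v :: "nat \<Rightarrow> nat \<Rightarrow> real"
  side_rho :: "nat \<Rightarrow> nat \<Rightarrow> real"
  side_w :: "nat \<Rightarrow> nat \<Rightarrow> real"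

text \<open>
  \<open>a \<ell>\<close>, \<open>b \<ell>\<close> (\<open>\<ell> = 1, 2, 3, 4\<close>) are the spatial, \<open>ta \<ell>\<close>, \<open>tb \<ell>\<close> (\<open>\<ell> = 1, 2\<close>) the temporal and
  \<open>na\<close>, \<open>nb\<close> the noise coefficients; the temporal and noise matrices enter transposed.
  \<open>\<xi> i\<close> is the noise increment at spatial stage \<open>i\<close>.
\<close>

definition PRK_skdv ::
    "nat \<Rightarrow> nat \<Rightarrow> real \<Rightarrow> real \<Rightarrow> real \<Rightarrow> real \<Rightarrow>
     (nat \<Rightarrow> nat \<Rightarrow> nat \<Rightarrow> real) \<Rightarrow> (nat \<Rightarrow> nat \<Rightarrow> real) \<Rightarrow>
     (nat \<Rightarrow> nat \<Rightarrow> nat \<Rightarrow> real) \<Rightarrow> (nat \<Rightarrow> nat \<Rightarrow> real) \<Rightarrow>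
     (nat \<Rightarrow> nat \<Rightarrow> real) \<Rightarrow> (nat \<Rightarrow> real) \<Rightarrow>
     (nat \<Rightarrow> real) \<Rightarrow> cell \<Rightarrow> bool" where
  "PRK_skdv s r \<beta> lam \<Delta>x \<Delta>t a b ta tb na nb \<xi> z \<longleftrightarrow>
     (\<forall>i\<in>{1..s}. \<forall>m\<in>{1..r}.
        stage_u z i m = time_u z 0 i
          + \<Delta>t * (\<Sum>n=1..r. ta 1 n m * (- 2 * stage_dxv z i n))
          + (\<Sum>n=1..r. 2 * lam * \<xi> i * na n m) \<and>
        stage_rho z i m = time_rho z 0 i
          + \<Delta>t * (\<Sum>n=1..r. ta 2 n m *
              (- 2 * \<beta> * stage_dxw z i n + 2 * stage_v z i n - (stage_u z i n)\<^sup>2)) \<and>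
        stage_u z i m = side_u z 0 m + \<Delta>x * (\<Sum>j=1..s. a 1 i j * stage_w z j m) \<and>
        stage_rho z i m = side_rho z 0 m + \<Delta>x * (\<Sum>j=1..s. a 2 i j * stage_u z j m) \<and>
        stage_v z i m = side_v z 0 m + \<Delta>x * (\<Sum>j=1..s. a 3 i j * stage_dxv z j m) \<and>
        stage_w z i m = side_w z 0 m + \<Delta>x * (\<Sum>j=1..s. a 4 i j * stage_dxw z j m)) \<and>
     (\<forall>i\<in>{1..s}.
        time_u z 1 i = time_u z 0 i
          + \<Delta>t * (\<Sum>m=1..r. tb 1 m * (- 2 * stage_dxv z i m))
          + (\<Sum>m=1..r. 2 * lam * \<xi> i * nb m) \<and>
        time_rho z 1 i = time_rho z 0 i
          + \<Delta>t * (\<Sum>m=1..r. tb 2 m *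
              (- 2 * \<beta> * stage_dxw z i m + 2 * stage_v z i m - (stage_u z i m)\<^sup>2))) \<and>
     (\<forall>m\<in>{1..r}.
        side_u z 1 m = side_u z 0 m + \<Delta>x * (\<Sum>i=1..s. b 1 i * stage_w z i m) \<and>
        side_rho z 1 m = side_rho z 0 m + \<Delta>x * (\<Sum>i=1..s. b 2 i * stage_u z i m) \<and>
        side_v z 1 m = side_v z 0 m + \<Delta>x * (\<Sum>i=1..s. b 3 i * stage_dxv z i m) \<and>
        side_w z 1 m = side_w z 0 m + \<Delta>x * (\<Sum>i=1..s. b 4 i * stage_dxw z i m))"

section \<open>Differentials of the numerical quantities\<close>

definition cell_differentiable_at ::
    "nat \<Rightarrow> nat \<Rightarrow> ('p::real_normed_vector \<Rightarrow> cell) \<Rightarrow> 'p \<Rightarrow> bool" where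
  "cell_differentiable_at s r z p \<longleftrightarrow>
     (\<forall>i\<in>{1..s}. \<forall>m\<in>{1..r}.
        (\<lambda>q. stage_u (z q) i m) differentiable (at p) \<and>
        (\<lambda>q. stage_v (z q) i m) differentiable (at p) \<and>
        (\<lambda>q. stage_rho (z q) i m) differentiable (at p) \<and>
        (\<lambda>q. stage_w (z q) i m) differentiable (at p) \<and>
        (\<lambda>q. stage_dxv (z q) i m) differentiable (at p) \<and>
        (\<lambda>q. stage_dxw (z q) i m) differentiable (at p)) \<and>
     (\<forall>k\<in>{0, 1}. \<forall>i\<in>{1..s}.
        (\<lambda>q. time_u (z q) k i) differentiable (at p) \<and>
        (\<lambda>q. time_rho (z q) k i) differentiable (at p)) \<and>
     (\<forall>k\<in>{0, 1}. \<forall>m\<in>{1..r}.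
        (\<lambda>q. side_u (z q) k m) differentiable (at p) \<and>
        (\<lambda>q. side_v (z q) k m) differentiable (at p) \<and>
        (\<lambda>q. side_rho (z q) k m) differentiable (at p) \<and>
        (\<lambda>q. side_w (z q) k m) differentiable (at p))"

text \<open>\<open>ext_d p f\<close> is the 1-form \<open>df\<close> at the parameter \<open>p\<close>.\<close>

definition ext_d :: "'p::real_normed_vector \<Rightarrow> ('p \<Rightarrow> real) \<Rightarrow> 'p \<Rightarrow> real" where
  "ext_d p f = frechet_derivative f (at p)"

definition wedge :: "('p \<Rightarrow> real) \<Rightarrow> ('p \<Rightarrow> real) \<Rightarrow> 'p \<Rightarrow> 'p \<Rightarrow> real" where
  "wedge \<phi> \<psi> = (\<lambda>\<eta> \<zeta>. \<phi> \<eta> * \<psi> \<zeta> - \<phi> \<zeta> * \<psi> \<eta>)"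

text \<open>The 2-form on the left-hand side of the discrete conservation law, evaluated at \<open>(\<eta>, \<zeta>)\<close>.\<close>

definition multisymplectic_form ::
    "nat \<Rightarrow> nat \<Rightarrow> real \<Rightarrow> real \<Rightarrow> real \<Rightarrow>
     (nat \<Rightarrow> nat \<Rightarrow> real) \<Rightarrow> (nat \<Rightarrow> nat \<Rightarrow> real) \<Rightarrow>
     ('p::real_normed_vector \<Rightarrow> cell) \<Rightarrow> 'p \<Rightarrow> 'p \<Rightarrow> 'p \<Rightarrow> real" where
  "multisymplectic_form s r \<beta> \<Delta>x \<Delta>t b tb z p \<eta> \<zeta> =
     (\<Sum>i=1..s. b 2 i / \<Delta>t *
        (wedge (ext_d p (\<lambda>q. time_rho (z q) 1 i)) (ext_d p (\<lambda>q. time_u (z q) 1 i)) \<eta> \<zeta>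
         - wedge (ext_d p (\<lambda>q. time_rho (z q) 0 i)) (ext_d p (\<lambda>q. time_u (z q) 0 i)) \<eta> \<zeta>)) +
     (\<Sum>m=1..r. tb 2 m / \<Delta>x *
        (2 * wedge (ext_d p (\<lambda>q. side_rho (z q) 1 m)) (ext_d p (\<lambda>q. side_v (z q) 1 m)) \<eta> \<zeta>
         - 2 * wedge (ext_d p (\<lambda>q. side_rho (z q) 0 m)) (ext_d p (\<lambda>q. side_v (z q) 0 m)) \<eta> \<zeta>
         + 2 * \<beta> * wedge (ext_d p (\<lambda>q. side_w (z q) 1 m)) (ext_d p (\<lambda>q. side_u (z q) 1 m)) \<eta> \<zeta>
         - 2 * \<beta> * wedge (ext_d p (\<lambda>q. side_w (z q) 0 m)) (ext_d p (\<lambda>q. side_u (z q) 0 m)) \<eta> \<zeta>))"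

end

(*
  Each pair of coefficient conditions is the symplecticity condition of a partitioned
  Runge-Kutta pair; it removes the stage-by-stage cross terms from the increment of a product of
  two quantities advanced by that pair. Applied to the differentials in time for (rho, u) and in
  space for (rho, v) and (w, u), it turns the increments of the wedge products into sums over the
  stages (i, m), which cancel: dU \<and> dU = dW \<and> dW = 0, and the noise, being independent of the
  parameter, has no differential.
*)
theory Submission
  imports Defs
begin

section \<open>Increments of products along a partitioned Runge-Kutta pair\<close>

text \<open>Writing \<open>x0\<close> and \<open>y0\<close> through the stage values
  \<open>X j\<close> and \<open>Y j\<close> in the expanded product leaves, besides the claimed
  terms, only terms \<open>f j * g k\<close> with coefficient
  \<open>b j * c k - b j * C j k - c k * A k j\<close> (times the square of \<open>h\<close>), which
  \<open>sympl\<close> makes vanish.\<close>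

lemma partitioned_RK_product_increment:
  fixes y0 y1 x0 x1 h :: real
  assumes y1: "y1 = y0 + h * (\<Sum>j\<in>J. b j * f j)"
    and x1: "x1 = x0 + h * (\<Sum>j\<in>J. c j * g j)"
    and Y: "\<And>j. j \<in> J \<Longrightarrow> Y j = y0 + h * (\<Sum>k\<in>J. A j k * f k)"
    and X: "\<And>j. j \<in> J \<Longrightarrow> X j = x0 + h * (\<Sum>k\<in>J. C j k * g k)"
    and sympl: "\<And>j k. j \<in> J \<Longrightarrow> k \<in> J \<Longrightarrow> b j * C j k + c k * A k j = b j * c k"
  shows "y1 * x1 - y0 * x0 = h * (\<Sum>j\<in>J. b j * (f j * X j) + c j * (Y j * g j))"
proof -
  have fX: "(\<Sum>j\<in>J. b j * (f j * X j))
      = (\<Sum>j\<in>J. b j * f j) * x0 + h * (\<Sum>j\<in>J. \<Sum>k\<in>J. b j * C j k * (f j * g k))"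
    by (simp add: X distrib_left sum.distrib sum_distrib_left sum_distrib_right mult_ac)
  have "(\<Sum>j\<in>J. c j * (Y j * g j))
      = y0 * (\<Sum>j\<in>J. c j * g j) + h * (\<Sum>k\<in>J. \<Sum>j\<in>J. c k * A k j * (f j * g k))"
    by (simp add: Y distrib_left distrib_right sum.distrib sum_distrib_left sum_distrib_right mult_ac)
  \<comment> \<open>The sums are exchanged so that \<open>f\<close> carries the outer index as in
    \<open>fX\<close>; the two coefficients then combine as in \<open>sympl\<close>.\<close>
  also have "(\<Sum>k\<in>J. \<Sum>j\<in>J. c k * A k j * (f j * g k))
      = (\<Sum>j\<in>J. \<Sum>k\<in>J. c k * A k j * (f j * g k))"
    by (rule sum.swap)
  finally have Yg: "(\<Sum>j\<in>J. c j * (Y j * g j))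
      = y0 * (\<Sum>j\<in>J. c j * g j) + h * (\<Sum>j\<in>J. \<Sum>k\<in>J. c k * A k j * (f j * g k))" .
  have "(\<Sum>j\<in>J. b j * f j) * (\<Sum>j\<in>J. c j * g j)
      = (\<Sum>j\<in>J. \<Sum>k\<in>J. b j * c k * (f j * g k))"
    by (simp add: sum_product mult_ac)
  also have "\<dots> = (\<Sum>j\<in>J. \<Sum>k\<in>J. (b j * C j k + c k * A k j) * (f j * g k))"
    by (intro sum.cong refl) (simp add: sympl)
  also have "\<dots> = (\<Sum>j\<in>J. \<Sum>k\<in>J. b j * C j k * (f j * g k))
      + (\<Sum>j\<in>J. \<Sum>k\<in>J. c k * A k j * (f j * g k))"
    by (simp add: distrib_right sum.distrib)
  finally have cross: "(\<Sum>j\<in>J. b j * f j) * (\<Sum>j\<in>J. c j * g j)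
      = (\<Sum>j\<in>J. \<Sum>k\<in>J. b j * C j k * (f j * g k))
        + (\<Sum>j\<in>J. \<Sum>k\<in>J. c k * A k j * (f j * g k))" .
  have "y1 * x1 - y0 * x0
      = h * ((\<Sum>j\<in>J. b j * f j) * x0 + y0 * (\<Sum>j\<in>J. c j * g j)
        + h * ((\<Sum>j\<in>J. b j * f j) * (\<Sum>j\<in>J. c j * g j)))"
    by (simp add: y1 x1 algebra_simps)
  then show ?thesis
    unfolding cross sum.distrib fX Yg by (simp add: algebra_simps)
qed

text \<open>The wedge antisymmetrizes the product of \<open>y\<close> at \<eta> and \<open>x\<close>
  at \<zeta>, so the product identity is used twice, the second time with the two arguments
  exchanged.\<close>

lemma partitioned_RK_wedge_increment:
  assumes y1: "\<And>\<eta>. y1 \<eta> = y0 \<eta> + h * (\<Sum>j\<in>J. b j * f j \<eta>)"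
    and x1: "\<And>\<eta>. x1 \<eta> = x0 \<eta> + h * (\<Sum>j\<in>J. c j * g j \<eta>)"
    and Y: "\<And>j \<eta>. j \<in> J \<Longrightarrow> Y j \<eta> = y0 \<eta> + h * (\<Sum>k\<in>J. A j k * f k \<eta>)"
    and X: "\<And>j \<eta>. j \<in> J \<Longrightarrow> X j \<eta> = x0 \<eta> + h * (\<Sum>k\<in>J. C j k * g k \<eta>)"
    and sympl: "\<And>j k. j \<in> J \<Longrightarrow> k \<in> J \<Longrightarrow> b j * C j k + c k * A k j = b j * c k"
  shows "wedge y1 x1 \<eta> \<zeta> - wedge y0 x0 \<eta> \<zeta>
    = h * (\<Sum>j\<in>J. b j * wedge (f j) (X j) \<eta> \<zeta> + c j * wedge (Y j) (g j) \<eta> \<zeta>)"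
proof -
  have incr: "y1 \<eta> * x1 \<zeta> - y0 \<eta> * x0 \<zeta>
      = h * (\<Sum>j\<in>J. b j * (f j \<eta> * X j \<zeta>) + c j * (Y j \<eta> * g j \<zeta>))" for \<eta> \<zeta>
    by (rule partitioned_RK_product_increment[OF y1 x1 Y X sympl])
  have "wedge y1 x1 \<eta> \<zeta> - wedge y0 x0 \<eta> \<zeta>
      = (y1 \<eta> * x1 \<zeta> - y0 \<eta> * x0 \<zeta>) - (y1 \<zeta> * x1 \<eta> - y0 \<zeta> * x0 \<eta>)"
    by (simp add: wedge_def)
  also have "\<dots> = h * (\<Sum>j\<in>J. b j * wedge (f j) (X j) \<eta> \<zeta> + c j * wedge (Y j) (g j) \<eta> \<zeta>)"
    unfolding incr right_diff_distrib[symmetric] sum_subtractf[symmetric] wedge_def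
    by (simp add: algebra_simps)
  finally show ?thesis .
qed

section \<open>Differentiating the equations of the scheme\<close>

text \<open>The scheme is only known on the parameter set \<open>P\<close>; openness makes an
  equation hold near \<open>p\<close>, which suffices to carry the derivative over, and Frechet
  derivatives are unique.\<close>

lemma ext_d_eqI:
  assumes "open P" "p \<in> P" "\<And>q. q \<in> P \<Longrightarrow> f q = g q" "(g has_derivative g') (at p)"
  shows "ext_d p f = g'"
proof -
  have "(f has_derivative g') (at p)"
    using assms by (metis has_derivative_transform_within_open)
  then show ?thesis
    unfolding ext_d_def by (metis frechet_derivative_at)
qed

lemma has_derivative_ext_d:
  "f differentiable (at p) \<Longrightarrow> (f has_derivative ext_d p f) (at p)"
  by (simp add: ext_d_def frechet_derivative_works)

text \<open>This is the common shape of all equations of the scheme. \<open>C\<close> receives the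
  noise sum: it is constant in \<open>q\<close>, so it contributes no differential.\<close>

lemma ext_d_RK_step:
  fixes f g :: "'p::real_normed_vector \<Rightarrow> real"
  assumes "open P" "p \<in> P"
    and "\<And>q. q \<in> P \<Longrightarrow> f q = g q + h * (\<Sum>j\<in>J. c j * k j q) + C"
    and "g differentiable (at p)"
    and "\<And>j. j \<in> J \<Longrightarrow> (k j has_derivative k' j) (at p)"
  shows "ext_d p f \<eta> = ext_d p g \<eta> + h * (\<Sum>j\<in>J. c j * k' j \<eta>)"
proof -
  have "((\<lambda>q. g q + h * (\<Sum>j\<in>J. c j * k j q) + C) has_derivative
      (\<lambda>\<eta>. ext_d p g \<eta> + h * (\<Sum>j\<in>J. c j * k' j \<eta>) + 0)) (at p)"
    by (intro has_derivative_add has_derivative_mult_right has_derivative_sum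
        has_derivative_const has_derivative_ext_d assms)
  from ext_d_eqI[OF assms(1-3) this] show ?thesis
    by simp
qed

text \<open>Equations without noise have no trailing summand, so it is removed here to let them
  unify with the rule.\<close>

lemmas ext_d_RK_step_noise_free = ext_d_RK_step[where C = 0, unfolded add_0_right]

section \<open>The conservation law for a single realization of the noise\<close>

text \<open>The increments \<open>\<xi>\<close> stay fixed while the parameter varies. The time part
  and the space part of the form turn out to be opposite double sums over the stages.\<close>

lemma multisymplectic_form_PRK_skdv_eq_0:
  fixes z :: "'p::real_normed_vector \<Rightarrow> cell"
  assumes "\<Delta>x \<noteq> 0" "\<Delta>t \<noteq> 0" and P: "open P" "p \<in> P"
    and diff: "cell_differentiable_at s r z p"
    and scheme: "\<And>q. q \<in> P \<Longrightarrow> PRK_skdv s r \<beta> lam \<Delta>x \<Delta>t a b ta tb na nb \<xi> (z q)"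
    and time: "\<forall>m\<in>{1..r}. \<forall>n\<in>{1..r}. ta 1 m n * tb 2 n + tb 1 m * ta 2 n m - tb 1 m * tb 2 n = 0"
    and space_rho_v: "\<forall>i\<in>{1..s}. \<forall>j\<in>{1..s}. a 3 i j * b 2 i + b 3 j * a 2 j i - b 2 i * b 3 j = 0"
    and space_w_u: "\<forall>i\<in>{1..s}. \<forall>j\<in>{1..s}. a 1 i j * b 4 i + b 1 j * a 4 j i - b 4 i * b 1 j = 0"
    and b23: "\<forall>i\<in>{1..s}. b 2 i = b 3 i"
    and b24: "\<forall>i\<in>{1..s}. b 2 i = b 4 i"
    and tb12: "\<forall>m\<in>{1..r}. tb 1 m = tb 2 m"
  shows "multisymplectic_form s r \<beta> \<Delta>x \<Delta>t b tb z p \<eta> \<zeta> = 0"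
proof -
  define dU where "dU i m = ext_d p (\<lambda>q. stage_u (z q) i m)" for i m
  define dV where "dV i m = ext_d p (\<lambda>q. stage_v (z q) i m)" for i m
  define dR where "dR i m = ext_d p (\<lambda>q. stage_rho (z q) i m)" for i m
  define dW where "dW i m = ext_d p (\<lambda>q. stage_w (z q) i m)" for i m
  define dVx where "dVx i m = ext_d p (\<lambda>q. stage_dxv (z q) i m)" for i m
  define dWx where "dWx i m = ext_d p (\<lambda>q. stage_dxw (z q) i m)" for i m
  define tu where "tu k i = ext_d p (\<lambda>q. time_u (z q) k i)" for k i
  define tr where "tr k i = ext_d p (\<lambda>q. time_rho (z q) k i)" for k i
  define su where "su k m = ext_d p (\<lambda>q. side_u (z q) k m)" for k m
  define sv where "sv k m = ext_d p (\<lambda>q. side_v (z q) k m)" for k m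
  define sr where "sr k m = ext_d p (\<lambda>q. side_rho (z q) k m)" for k m
  define sw where "sw k m = ext_d p (\<lambda>q. side_w (z q) k m)" for k m
  \<comment> \<open>\<open>F\<close> and \<open>G\<close> are the differentials of the right-hand
    sides of the temporal equations for u and \<rho>. The last term of \<open>G\<close> linearizes
    the square of U; being a multiple of \<open>dU\<close>, it disappears when wedged with
    \<open>dU\<close>.\<close>
  define F where "F i m = (\<lambda>\<eta>. - 2 * dVx i m \<eta>)" for i m
  define G where "G i m = (\<lambda>\<eta>. - 2 * \<beta> * dWx i m \<eta> + 2 * dV i m \<eta>
      - 2 * stage_u (z p) i m * dU i m \<eta>)" for i m
  have stage_deriv:
    "((\<lambda>q. stage_u (z q) i m) has_derivative dU i m) (at p)"
    "((\<lambda>q. stage_v (z q) i m) has_derivative dV i m) (at p)"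
    "((\<lambda>q. stage_w (z q) i m) has_derivative dW i m) (at p)"
    "((\<lambda>q. stage_dxv (z q) i m) has_derivative dVx i m) (at p)"
    "((\<lambda>q. stage_dxw (z q) i m) has_derivative dWx i m) (at p)"
    if "i \<in> {1..s}" "m \<in> {1..r}" for i m
    using diff that unfolding cell_differentiable_at_def dU_def dV_def dW_def dVx_def dWx_def
    by (blast intro: has_derivative_ext_d)+
  have F_deriv: "((\<lambda>q. - 2 * stage_dxv (z q) i m) has_derivative F i m) (at p)"
    if "i \<in> {1..s}" "m \<in> {1..r}" for i m
    unfolding F_def by (intro has_derivative_mult_right stage_deriv that)
  have G_deriv: "((\<lambda>q. - 2 * \<beta> * stage_dxw (z q) i m + 2 * stage_v (z q) i m
      - (stage_u (z q) i m)\<^sup>2) has_derivative G i m) (at p)"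
    if "i \<in> {1..s}" "m \<in> {1..r}" for i m
    unfolding G_def power2_eq_square
    by (rule derivative_eq_intros stage_deriv that refl | simp add: fun_eq_iff algebra_simps)+
  have time_diff:
    "(\<lambda>q. time_u (z q) 0 i) differentiable (at p)"
    "(\<lambda>q. time_rho (z q) 0 i) differentiable (at p)" if "i \<in> {1..s}" for i
    using diff that unfolding cell_differentiable_at_def by blast+
  have side_diff:
    "(\<lambda>q. side_u (z q) 0 m) differentiable (at p)"
    "(\<lambda>q. side_v (z q) 0 m) differentiable (at p)"
    "(\<lambda>q. side_rho (z q) 0 m) differentiable (at p)"
    "(\<lambda>q. side_w (z q) 0 m) differentiable (at p)" if "m \<in> {1..r}" for m
    using diff that unfolding cell_differentiable_at_def by blast+
  note step = ext_d_RK_step_noise_free[OF P]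
  note noisy_step = ext_d_RK_step[OF P]
  note scheme_eqs = scheme[unfolded PRK_skdv_def]
  \<comment> \<open>The noise sum in the equation for U is matched with the constant
    \<open>C\<close>, so it is absent from the linearized equations.\<close>
  have time_stage:
    "dU i m \<eta> = tu 0 i \<eta> + \<Delta>t * (\<Sum>n=1..r. ta 1 n m * F i n \<eta>)"
    "dR i m \<eta> = tr 0 i \<eta> + \<Delta>t * (\<Sum>n=1..r. ta 2 n m * G i n \<eta>)"
    if i: "i \<in> {1..s}" and m: "m \<in> {1..r}" for i m \<eta>
    unfolding dU_def tu_def dR_def tr_def
    using scheme_eqs i m
    by (intro noisy_step[OF _ time_diff(1)[OF i] F_deriv[OF i]]
          step[OF _ time_diff(2)[OF i] G_deriv[OF i]];
        blast)+
  have time_step: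
    "tu 1 i \<eta> = tu 0 i \<eta> + \<Delta>t * (\<Sum>m=1..r. tb 1 m * F i m \<eta>)"
    "tr 1 i \<eta> = tr 0 i \<eta> + \<Delta>t * (\<Sum>m=1..r. tb 2 m * G i m \<eta>)"
    if i: "i \<in> {1..s}" for i \<eta>
    unfolding tu_def tr_def
    using scheme_eqs i
    by (intro noisy_step[OF _ time_diff(1)[OF i] F_deriv[OF i]]
          step[OF _ time_diff(2)[OF i] G_deriv[OF i]];
        blast)+
  have space_stage:
    "dU i m \<eta> = su 0 m \<eta> + \<Delta>x * (\<Sum>j=1..s. a 1 i j * dW j m \<eta>)"
    "dR i m \<eta> = sr 0 m \<eta> + \<Delta>x * (\<Sum>j=1..s. a 2 i j * dU j m \<eta>)"
    "dV i m \<eta> = sv 0 m \<eta> + \<Delta>x * (\<Sum>j=1..s. a 3 i j * dVx j m \<eta>)"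
    "dW i m \<eta> = sw 0 m \<eta> + \<Delta>x * (\<Sum>j=1..s. a 4 i j * dWx j m \<eta>)"
    if i: "i \<in> {1..s}" and m: "m \<in> {1..r}" for i m \<eta>
    \<comment> \<open>Only the differentials at stage \<open>i\<close> are unfolded; those under the
      sums, at stage \<open>j\<close>, stay folded to match \<open>stage_deriv\<close>.\<close>
    unfolding dU_def[of i] dR_def[of i] dV_def[of i] dW_def[of i] su_def sr_def sv_def sw_def
    using scheme_eqs i m
    by (intro step[OF _ side_diff(1)[OF m] stage_deriv(3)[OF _ m]]
          step[OF _ side_diff(3)[OF m] stage_deriv(1)[OF _ m]]
          step[OF _ side_diff(2)[OF m] stage_deriv(4)[OF _ m]]
          step[OF _ side_diff(4)[OF m] stage_deriv(5)[OF _ m]];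
        blast)+
  have space_step:
    "su 1 m \<eta> = su 0 m \<eta> + \<Delta>x * (\<Sum>i=1..s. b 1 i * dW i m \<eta>)"
    "sr 1 m \<eta> = sr 0 m \<eta> + \<Delta>x * (\<Sum>i=1..s. b 2 i * dU i m \<eta>)"
    "sv 1 m \<eta> = sv 0 m \<eta> + \<Delta>x * (\<Sum>i=1..s. b 3 i * dVx i m \<eta>)"
    "sw 1 m \<eta> = sw 0 m \<eta> + \<Delta>x * (\<Sum>i=1..s. b 4 i * dWx i m \<eta>)"
    if m: "m \<in> {1..r}" for m \<eta>
    unfolding su_def sr_def sv_def sw_def
    using scheme_eqs m
    by (intro step[OF _ side_diff(1)[OF m] stage_deriv(3)[OF _ m]]
          step[OF _ side_diff(3)[OF m] stage_deriv(1)[OF _ m]]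
          step[OF _ side_diff(2)[OF m] stage_deriv(4)[OF _ m]]
          step[OF _ side_diff(4)[OF m] stage_deriv(5)[OF _ m]];
        blast)+
  \<comment> \<open>The temporal matrices enter the scheme transposed, hence the swapped indices in
    \<open>A\<close> and \<open>C\<close>.\<close>
  have incr_time: "wedge (tr 1 i) (tu 1 i) \<eta> \<zeta> - wedge (tr 0 i) (tu 0 i) \<eta> \<zeta>
      = \<Delta>t * (\<Sum>m=1..r. tb 2 m * wedge (G i m) (dU i m) \<eta> \<zeta> + tb 1 m * wedge (dR i m) (F i m) \<eta> \<zeta>)"
    if "i \<in> {1..s}" for i
    using time that
    by (intro partitioned_RK_wedge_increment[where A = "\<lambda>m n. ta 2 n m" and C = "\<lambda>m n. ta 1 n m"]
        time_step time_stage) (auto simp: algebra_simps)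
  have incr_rho_v: "wedge (sr 1 m) (sv 1 m) \<eta> \<zeta> - wedge (sr 0 m) (sv 0 m) \<eta> \<zeta>
      = \<Delta>x * (\<Sum>i=1..s. b 2 i * wedge (dU i m) (dV i m) \<eta> \<zeta> + b 3 i * wedge (dR i m) (dVx i m) \<eta> \<zeta>)"
    if "m \<in> {1..r}" for m
    using space_rho_v that
    by (intro partitioned_RK_wedge_increment[where A = "a 2" and C = "a 3"]
        space_step space_stage) (auto simp: algebra_simps)
  \<comment> \<open>Since w discretizes the spatial derivative of u, the increments of u are driven
    by \<open>dW\<close> itself; the second wedge is therefore zero and takes the weight
    \<open>b 1\<close> with it.\<close>
  have incr_w_u: "wedge (sw 1 m) (su 1 m) \<eta> \<zeta> - wedge (sw 0 m) (su 0 m) \<eta> \<zeta>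
      = \<Delta>x * (\<Sum>i=1..s. b 4 i * wedge (dWx i m) (dU i m) \<eta> \<zeta> + b 1 i * wedge (dW i m) (dW i m) \<eta> \<zeta>)"
    if "m \<in> {1..r}" for m
    using space_w_u that
    by (intro partitioned_RK_wedge_increment[where A = "a 4" and C = "a 1"]
        space_step space_stage) (auto simp: algebra_simps)
  \<comment> \<open>\<open>T i m\<close> is the contribution of one stage to the space part, once
    the weights agree and the step size has cancelled against the denominator.\<close>
  define T where "T i m = b 2 i * tb 2 m *
      (2 * wedge (dU i m) (dV i m) \<eta> \<zeta> + 2 * wedge (dR i m) (dVx i m) \<eta> \<zeta>
       + 2 * \<beta> * wedge (dWx i m) (dU i m) \<eta> \<zeta>)" for i m
  have time_T: "b 2 i / \<Delta>t * (wedge (tr 1 i) (tu 1 i) \<eta> \<zeta> - wedge (tr 0 i) (tu 0 i) \<eta> \<zeta>)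
      = - (\<Sum>m=1..r. T i m)" if "i \<in> {1..s}" for i
  proof -
    have "b 2 i / \<Delta>t * (wedge (tr 1 i) (tu 1 i) \<eta> \<zeta> - wedge (tr 0 i) (tu 0 i) \<eta> \<zeta>)
        = (\<Sum>m=1..r. b 2 i * (tb 2 m * wedge (G i m) (dU i m) \<eta> \<zeta>
            + tb 1 m * wedge (dR i m) (F i m) \<eta> \<zeta>))"
      using \<open>\<Delta>t \<noteq> 0\<close> unfolding incr_time[OF that] sum_distrib_left[symmetric] by simp
    \<comment> \<open>With equal temporal weights, the minus signs come from exchanging
      \<open>dV\<close> and \<open>dU\<close> in the wedge and from the factors -2 in
      \<open>F\<close> and \<open>G\<close>.\<close>
    also have "\<dots> = (\<Sum>m=1..r. - T i m)"
      using tb12 by (intro sum.cong refl) (simp add: T_def F_def G_def wedge_def algebra_simps)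
    finally show ?thesis by (simp add: sum_negf)
  qed
  have space_T: "tb 2 m / \<Delta>x *
      (2 * wedge (sr 1 m) (sv 1 m) \<eta> \<zeta> - 2 * wedge (sr 0 m) (sv 0 m) \<eta> \<zeta>
       + 2 * \<beta> * wedge (sw 1 m) (su 1 m) \<eta> \<zeta> - 2 * \<beta> * wedge (sw 0 m) (su 0 m) \<eta> \<zeta>)
      = (\<Sum>i=1..s. T i m)" if "m \<in> {1..r}" for m
  proof -
    have "2 * wedge (sr 1 m) (sv 1 m) \<eta> \<zeta> - 2 * wedge (sr 0 m) (sv 0 m) \<eta> \<zeta>
       + 2 * \<beta> * wedge (sw 1 m) (su 1 m) \<eta> \<zeta> - 2 * \<beta> * wedge (sw 0 m) (su 0 m) \<eta> \<zeta>
      = 2 * (wedge (sr 1 m) (sv 1 m) \<eta> \<zeta> - wedge (sr 0 m) (sv 0 m) \<eta> \<zeta>)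
       + 2 * \<beta> * (wedge (sw 1 m) (su 1 m) \<eta> \<zeta> - wedge (sw 0 m) (su 0 m) \<eta> \<zeta>)"
      by (simp add: algebra_simps)
    also have "\<dots> = \<Delta>x * (\<Sum>i=1..s.
        2 * (b 2 i * wedge (dU i m) (dV i m) \<eta> \<zeta> + b 3 i * wedge (dR i m) (dVx i m) \<eta> \<zeta>)
        + 2 * \<beta> * (b 4 i * wedge (dWx i m) (dU i m) \<eta> \<zeta> + b 1 i * wedge (dW i m) (dW i m) \<eta> \<zeta>))"
      unfolding incr_rho_v[OF that] incr_w_u[OF that] sum.distrib sum_distrib_left[symmetric]
      by (simp add: algebra_simps)
    \<comment> \<open>The equalities \<open>b23\<close> and \<open>b24\<close> give the remaining
      wedges the common weight \<open>b 2 i\<close>.\<close>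
    also have "\<dots> = \<Delta>x * (\<Sum>i=1..s. b 2 i *
        (2 * wedge (dU i m) (dV i m) \<eta> \<zeta> + 2 * wedge (dR i m) (dVx i m) \<eta> \<zeta>
         + 2 * \<beta> * wedge (dWx i m) (dU i m) \<eta> \<zeta>))"
      using b23 b24
      by (intro arg_cong[where f = "(*) \<Delta>x"] sum.cong refl) (simp add: wedge_def algebra_simps)
    finally show ?thesis
      using \<open>\<Delta>x \<noteq> 0\<close> by (simp add: T_def sum_distrib_left mult_ac)
  qed
  have "multisymplectic_form s r \<beta> \<Delta>x \<Delta>t b tb z p \<eta> \<zeta>
      = (\<Sum>i=1..s. - (\<Sum>m=1..r. T i m)) + (\<Sum>m=1..r. \<Sum>i=1..s. T i m)"
    unfolding multisymplectic_form_def tr_def[symmetric] tu_def[symmetric] sr_def[symmetric]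
      sv_def[symmetric] sw_def[symmetric] su_def[symmetric]
    using time_T space_T by (intro arg_cong2[where f = "(+)"] sum.cong refl) auto
  also have "\<dots> = 0"
    by (simp add: sum_negf sum.swap[of T])
  finally show ?thesis .
qed

theorem mainTheorem8:
  fixes M :: "'w measure"
    and D :: "real set"
    and Q :: "(real \<Rightarrow> real) \<Rightarrow> (real \<Rightarrow> real)"
    and W :: "real \<Rightarrow> 'w \<Rightarrow> real \<Rightarrow> real"
    and s r :: nat
    and \<beta> lam \<Delta>x \<Delta>t :: real
    and a :: "nat \<Rightarrow> nat \<Rightarrow> nat \<Rightarrow> real"
    and b :: "nat \<Rightarrow> nat \<Rightarrow> real"
    and ta :: "nat \<Rightarrow> nat \<Rightarrow> nat \<Rightarrow> real"
    and tb :: "nat \<Rightarrow> nat \<Rightarrow> real"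
    and na :: "nat \<Rightarrow> nat \<Rightarrow> real"
    and nb :: "nat \<Rightarrow> real"
    and x :: "nat \<Rightarrow> real"
    and P :: "'w \<Rightarrow> 'p::real_normed_vector set"
    and z :: "'w \<Rightarrow> 'p \<Rightarrow> cell"
  assumes "1 \<le> s" "1 \<le> r" "0 < \<beta>" "0 < lam" "0 < \<Delta>x" "0 < \<Delta>t"
    and "is_interval D" "{0..\<Delta>x} \<subseteq> D" "\<forall>i\<in>{1..s}. x i \<in> D"
    and "Q_Wiener_process M D Q W"
    and "AE \<omega> in M. open (P \<omega>)"
    and "AE \<omega> in M. \<forall>p\<in>P \<omega>. cell_differentiable_at s r (z \<omega>) p"
    and "AE \<omega> in M. \<forall>p\<in>P \<omega>.
           PRK_skdv s r \<beta> lam \<Delta>x \<Delta>t a b ta tb na nb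
             (\<lambda>i. W \<Delta>t \<omega> (x i) - W 0 \<omega> (x i)) (z \<omega> p)"
    and "\<forall>m\<in>{1..r}. \<forall>n\<in>{1..r}. ta 1 m n * tb 2 n + tb 1 m * ta 2 n m - tb 1 m * tb 2 n = 0"
    and "\<forall>m\<in>{1..r}. \<forall>n\<in>{1..r}. na m n * tb 2 n + nb m * ta 2 n m - nb m * tb 2 n = 0"
    and "\<forall>i\<in>{1..s}. \<forall>j\<in>{1..s}. a 3 i j * b 2 i + b 3 j * a 2 j i - b 2 i * b 3 j = 0"
    and "\<forall>i\<in>{1..s}. \<forall>j\<in>{1..s}. a 1 i j * b 4 i + b 1 j * a 4 j i - b 4 i * b 1 j = 0"
    and "\<forall>i\<in>{1..s}. b 2 i = b 3 i"
    and "\<forall>i\<in>{1..s}. b 2 i = b 4 i"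
    and "\<forall>m\<in>{1..r}. tb 1 m = tb 2 m"
  shows "AE \<omega> in M. \<forall>p\<in>P \<omega>. \<forall>\<eta> \<zeta>.
           multisymplectic_form s r \<beta> \<Delta>x \<Delta>t b tb (z \<omega>) p \<eta> \<zeta> = 0"
  \<comment> \<open>Openness, differentiability and the scheme hold together outside one null set,
    chosen before \<open>p\<close>, \<eta> and \<zeta>; there the result for one realization applies
    with \<open>\<xi>\<close> the increment of \<open>W\<close>.\<close>
  using assms(11-13)
proof eventually_elim
  case (elim \<omega>)
  show ?case
  proof (intro ballI allI)
    fix p \<eta> \<zeta>
    assume "p \<in> P \<omega>"
    with elim assms(5,6) show "multisymplectic_form s r \<beta> \<Delta>x \<Delta>t b tb (z \<omega>) p \<eta> \<zeta> = 0"
      by (intro multisymplectic_form_PRK_skdv_eq_0[OF _ _ elim(1) _ _ _ assms(14,16-20)]) auto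
  qed
qed

end
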